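(* Let $(\Omega,T,\mu)$ be a dynamical system and let $F\in AC(\Omega,T,\mu)$. Then the sequence $\left(\frac{H_n(F)}{n}\right)_{n\ge 1}$ converges to a limit $Se(F,T)$, which may be infinite (equal to $-\infty$). Moreover $$Se(F,T)\le \tfrac12\left(\log(2\pi)+\|F\|_2^2\right),$$ and equality holds if and only if for every $n\ge1$ the law $\mu F_n^{-1}$ of $(F,F\circ T,\dots,F\circ T^{n-1})$ is the independent Gaussian measure $\gamma_n$.
   Context: A dynamical system $(\Omega,T,\mu)$ is a probability space $(\Omega,\mu)$ with a measure-preserving transformation $T$. $AC(\Omega,T,\mu)$ denotes the set of real-valued $F\in L^2(\mu)$ such that for every $n\ge 1$ the law of $F_n:=(F,F\circ T,\dots,F\circ T^{n-1})$, denoted $\mu F_n^{-1}$, is absolutely continuous with respect to Lebesgue measure $l^n$ on $\mathbb R^n$. With $\psi(x)=-x\log x$ for $x>0$, $\psi(0)=0$ (natural logarithm), set $$H_n(F):=\int_{\mathbb R^n}\psi\left(\frac{d\mu F_n^{-1}}{dl^n}\right)dl^n\in[-\infty,\infty).$$ $\gamma_n$ is the $n$-fold product of the standard Gaussian measure $\gamma_0=\frac{1}{\sqrt{2\pi}}e^{-x^2/2}\,dx$ on $\mathbb R$. $\|F\|_2$ is the $L^2(\mu)$ norm. *)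

theory Defs
  imports "HOL-Probability.Probability"
begin

locale dynamical_system = prob_space M for M :: "'a measure" +
  fixes T :: "'a \<Rightarrow> 'a"
  assumes measurable_T: "T \<in> measurable M M"
    and measure_preserving_T: "distr M M T = M"

(* R^n is represented by the functions extensional on {..<n}, i.e. by the space of the product
   measures below. All measures on R^n live on its Borel sets, so leb n is the restriction of
   Lebesgue measure to them. *)

definition leb :: "nat \<Rightarrow> (nat \<Rightarrow> real) measure" where
  "leb n = PiM {..<n} (\<lambda>_. lborel)"

definition std_gauss :: "nat \<Rightarrow> (nat \<Rightarrow> real) measure" where
  "std_gauss n = PiM {..<n} (\<lambda>_. std_normal_distribution)"

definition orbit_vec :: "('a \<Rightarrow> 'a) \<Rightarrow> ('a \<Rightarrow> real) \<Rightarrow> nat \<Rightarrow> 'a \<Rightarrow> nat \<Rightarrow> real" where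
  "orbit_vec T F n \<omega> = (\<lambda>i\<in>{..<n}. F ((T ^^ i) \<omega>))"

definition orbit_law ::
    "'a measure \<Rightarrow> ('a \<Rightarrow> 'a) \<Rightarrow> ('a \<Rightarrow> real) \<Rightarrow> nat \<Rightarrow> (nat \<Rightarrow> real) measure" where
  "orbit_law M T F n = distr M (PiM {..<n} (\<lambda>_. borel)) (orbit_vec T F n)"

definition L2_functions :: "'a measure \<Rightarrow> ('a \<Rightarrow> real) set" where
  "L2_functions M = {F \<in> borel_measurable M. integrable M (\<lambda>\<omega>. (F \<omega>)\<^sup>2)}"

definition L2_norm :: "'a measure \<Rightarrow> ('a \<Rightarrow> real) \<Rightarrow> real" where
  "L2_norm M F = sqrt (\<integral>\<omega>. (F \<omega>)\<^sup>2 \<partial>M)"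

definition AC :: "'a measure \<Rightarrow> ('a \<Rightarrow> 'a) \<Rightarrow> ('a \<Rightarrow> real) set" where
  "AC M T = {F \<in> L2_functions M. \<forall>n\<ge>1. absolutely_continuous (leb n) (orbit_law M T F n)}"

definition psi :: "real \<Rightarrow> real" where
  "psi x = (if x > 0 then - x * ln x else 0)"

(* Integral of f^+ minus integral of f^- as an extended real; the coercion ennreal sends negative
   reals to 0. This is meaningful only if one of the two integrals is finite (for ereal,
   \<infinity> - \<infinity> = \<infinity>). For the entropy below the integral of the positive part is always finite, since F
   is square integrable. *)

definition ext_integral :: "'b measure \<Rightarrow> ('b \<Rightarrow> real) \<Rightarrow> ereal" where
  "ext_integral N f =
     enn2ereal (\<integral>\<^sup>+x. ennreal (f x) \<partial>N) - enn2ereal (\<integral>\<^sup>+x. ennreal (- f x) \<partial>N)"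

(* RN_deriv is ennreal-valued; here it is finite almost everywhere, so enn2real loses nothing. *)

definition entropy_n :: "'a measure \<Rightarrow> ('a \<Rightarrow> 'a) \<Rightarrow> ('a \<Rightarrow> real) \<Rightarrow> nat \<Rightarrow> ereal" where
  "entropy_n M T F n =
     ext_integral (leb n) (\<lambda>x. psi (enn2real (RN_deriv (leb n) (orbit_law M T F n) x)))"

(* lim is the unique limit if there is one and unspecified otherwise. *)

definition Se :: "'a measure \<Rightarrow> ('a \<Rightarrow> 'a) \<Rightarrow> ('a \<Rightarrow> real) \<Rightarrow> ereal" where
  "Se M T F = lim (\<lambda>n. entropy_n M T F n / ereal (real n))"

end

theory Submission
  imports Defs
begin

text \<open>Since the \<open>F \<circ> T ^^ i\<close> all have second moment \<open>\<parallel>F\<parallel>\<^sup>2\<close>, the entropy is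
  \<open>H\<^sub>n = n c - D\<^sub>n\<close>, where \<open>c\<close> is the claimed bound and \<open>D\<^sub>n\<close> the relative entropy of the orbit law with
  respect to the standard Gaussian measure. By stationarity and because the Gaussian measure is a
  product, \<open>D\<close> is superadditive, so that Fekete's lemma gives \<open>D\<^sub>n / n \<longlonglongrightarrow> sup D\<^sub>n / n\<close>. This supremum
  is nonnegative, and it vanishes iff every \<open>D\<^sub>n\<close> does, that is, iff all orbit laws are Gaussian.\<close>

section \<open>Fekete's lemma for superadditive sequences\<close>

text \<open>The supremum bounds the quotients from above for every \<open>n \<ge> 1\<close>. From
  below, cutting \<open>n\<close> into \<open>n div m\<close> blocks of length \<open>m\<close>
  gives \<open>a n \<ge> (n div m) * a m\<close>, and \<open>(n div m) / n\<close> tends to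
  \<open>1 / m\<close>; hence the quotients eventually exceed anything below \<open>a m / m\<close>,
  for each \<open>m\<close>.\<close>

lemma superadditive_tendsto_SUP:
  fixes a :: "nat \<Rightarrow> ennreal"
  assumes superadd: "\<And>m n. a m + a n \<le> a (m + n)"
  shows "(\<lambda>n. a n / of_nat n) \<longlonglongrightarrow> (SUP n\<in>{1..}. a n / of_nat n)"
proof (rule order_tendstoI)
  fix y assume "(SUP n\<in>{1..}. a n / of_nat n) < y"
  then show "\<forall>\<^sub>F n in sequentially. a n / of_nat n < y"
    by (intro eventually_sequentiallyI[of 1])
      (meson SUP_upper atLeast_iff le_less_trans)
next
  fix y assume "y < (SUP n\<in>{1..}. a n / of_nat n)"
  then obtain m where m: "m \<ge> 1" "y < a m / of_nat m"
    by (auto simp: less_SUP_iff)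
  have mult: "of_nat q * a m \<le> a (q * m + r)" for q r
  proof (induction q)
    case (Suc q)
    have "of_nat (Suc q) * a m = a m + of_nat q * a m"
      by (simp add: algebra_simps)
    also have "\<dots> \<le> a m + a (q * m + r)"
      using Suc by (intro add_left_mono) auto
    also have "\<dots> \<le> a (Suc q * m + r)"
      using superadd[of m "q * m + r"] by (simp add: add.assoc)
    finally show ?case .
  qed simp
  have lower: "of_nat (n div m) / of_nat n * a m \<le> a n / of_nat n" for n
    using divide_right_mono_ennreal[OF mult[of "n div m" "n mod m"], of "of_nat n"]
    by (simp add: ennreal_times_divide mult.commute)
  have "(\<lambda>n. real (n div m) / real n) \<longlonglongrightarrow> 1 / real m"
  proof (rule tendsto_sandwich)
    \<comment> \<open>This is \<open>n \<le> (n div m + 1) * m\<close> divided by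
      \<open>n * m\<close>.\<close>
    show "\<forall>\<^sub>F n in sequentially. 1 / real m - 1 / real n \<le> real (n div m) / real n"
    proof (rule eventually_sequentiallyI[of 1])
      fix n :: nat assume n: "1 \<le> n"
      have "n \<le> (n div m + 1) * m"
        using m by (metis Suc_eq_plus1 dividend_less_div_times less_imp_le_nat less_le_trans mult_Suc zero_less_one)
      then have "real n \<le> (real (n div m) + 1) * real m"
        by (metis of_nat_1 of_nat_add of_nat_le_iff of_nat_mult)
      then have "real n * real n \<le> real n * ((real (n div m) + 1) * real m)"
        by (intro mult_left_mono) auto
      then show "1 / real m - 1 / real n \<le> real (n div m) / real n"
        using n m by (simp add: field_simps)
    qed
    show "\<forall>\<^sub>F n in sequentially. real (n div m) / real n \<le> 1 / real m"
    proof (rule eventually_sequentiallyI[of 1])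
      fix n :: nat assume n: "1 \<le> n"
      have "real (n div m) * real m \<le> real n"
        by (metis of_nat_le_iff of_nat_mult times_div_less_eq_dividend mult.commute)
      then show "real (n div m) / real n \<le> 1 / real m"
        using n m by (simp add: field_simps)
    qed
  qed (auto intro!: tendsto_eq_intros lim_1_over_n)
  then have "(\<lambda>n. ennreal (real (n div m) / real n)) \<longlonglongrightarrow> ennreal (1 / real m)"
    by (rule tendsto_ennrealI)
  then have lim: "(\<lambda>n. a m * ennreal (real (n div m) / real n)) \<longlonglongrightarrow> a m * ennreal (1 / real m)"
    if "a m \<noteq> \<infinity>"
    using that by (intro ennreal_tendsto_cmult) (auto simp: less_top)
  show "\<forall>\<^sub>F n in sequentially. y < a n / of_nat n"
  \<comment> \<open>The limit \<open>lim\<close> is available for finite \<open>a m\<close> only. An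
    infinite value propagates instead: superadditivity makes \<open>a n\<close> infinite for all
    \<open>n \<ge> m\<close>.\<close>
  proof (cases "a m = \<infinity>")
    case True
    show ?thesis
    proof (rule eventually_sequentiallyI[of m])
      fix n assume "m \<le> n"
      then have "a n = \<infinity>"
        using superadd[of m "n - m"] True by (simp add: top_unique)
      then show "y < a n / of_nat n"
        using m(2) True by (auto simp: ennreal_top_divide less_top)
    qed
  next
    case False
    have "a m * ennreal (1 / real m) = a m / of_nat m"
      using m by (simp add: divide_ennreal_def inverse_ennreal ennreal_of_nat_eq_real_of_nat inverse_eq_divide)
    with m(2) lim[OF False] have "\<forall>\<^sub>F n in sequentially. y < a m * ennreal (real (n div m) / real n)"
      by (auto dest: order_tendstoD)
    then show ?thesis
      using eventually_ge_at_top[of 1]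
    proof eventually_elim
      case (elim n)
      have "a m * ennreal (real (n div m) / real n) = of_nat (n div m) / of_nat n * a m"
        using elim by (simp add: divide_ennreal ennreal_of_nat_eq_real_of_nat mult.commute)
      with elim lower[of n] show ?case by simp
    qed
  qed
qed

section \<open>Relative entropy: vanishing and superadditivity\<close>

text \<open>For a probability density \<open>p\<close> with respect to a probability measure, the terms \<open>- p x + 1\<close>
  integrate to 0; they make the integrand nonnegative.\<close>

definition relative_entropy :: "'b measure \<Rightarrow> ('b \<Rightarrow> real) \<Rightarrow> ennreal" where
  "relative_entropy N p = (\<integral>\<^sup>+x. ennreal (p x * ln (p x) - p x + 1) \<partial>N)"

text \<open>Convexity of \<open>x * ln x\<close>: its tangent at \<open>q\<close>, evaluated at
  \<open>p\<close>, is \<open>p * ln q + p - q\<close>. The proof uses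
  \<open>ln z \<le> z - 1\<close> at \<open>z = q / p\<close>. The case \<open>q = 0 < p\<close> is
  excluded because there the convention \<open>ln 0 = 0\<close> would make the inequality false, for
  instance at \<open>p = 1\<close>.\<close>

lemma mult_ln_ge_tangent:
  fixes p q :: real
  assumes "p \<ge> 0" "q \<ge> 0" "q = 0 \<Longrightarrow> p = 0"
  shows "p * ln q - q \<le> p * ln p - p"
proof (cases "p = 0")
  case False
  then have pos: "p > 0" "q > 0"
    using assms by (auto simp: less_le)
  then have "ln (q / p) \<le> q / p - 1"
    by (intro ln_le_minus_one) auto
  then have "p * ln (q / p) \<le> p * (q / p - 1)"
    using pos by (intro mult_left_mono) auto
  then show ?thesis
    using pos by (simp add: ln_div algebra_simps)
qed (use assms in auto)

text \<open>Equality case of the tangent inequality at \<open>q = 1\<close>: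
  \<open>ln z = z - 1\<close> forces \<open>z = 1\<close>, applied to \<open>z = 1 / p\<close>. At
  \<open>p = 0\<close> the left side is 1.\<close>

lemma mult_ln_tangent_eq_iff:
  fixes p :: real
  assumes "p \<ge> 0"
  shows "p * ln p - p + 1 = 0 \<longleftrightarrow> p = 1"
proof
  assume *: "p * ln p - p + 1 = 0"
  then have p: "p > 0"
    using assms by (cases "p = 0") auto
  then have "ln (1 / p) = 1 / p - 1"
    using * by (simp add: ln_div field_simps)
  then show "p = 1"
    using p ln_eq_minus_one[of "1 / p"] by simp
qed simp

text \<open>The integrand is nonnegative and vanishes only where \<open>p x = 1\<close>, so a zero
  integral means \<open>p = 1\<close> almost everywhere. Uniqueness of densities over a sigma-finite
  measure turns this into equality of measures.\<close>

lemma relative_entropy_eq_0_iff: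
  assumes N: "sigma_finite_measure N" and [measurable]: "p \<in> borel_measurable N"
    and nonneg: "\<And>x. p x \<ge> 0"
  shows "relative_entropy N p = 0 \<longleftrightarrow> density N p = N"
proof -
  interpret sigma_finite_measure N by fact
  have "relative_entropy N p = 0 \<longleftrightarrow> (AE x in N. p x * ln (p x) - p x + 1 \<le> 0)"
    unfolding relative_entropy_def by (simp add: nn_integral_0_iff_AE ennreal_eq_0_iff)
  also have "\<dots> \<longleftrightarrow> (AE x in N. ennreal (p x) = 1)"
  proof (rule AE_cong)
    fix x
    have "p x * ln (p x) - p x + 1 \<ge> 0"
      using mult_ln_ge_tangent[of "p x" 1] nonneg by simp
    then show "p x * ln (p x) - p x + 1 \<le> 0 \<longleftrightarrow> ennreal (p x) = 1"
      using mult_ln_tangent_eq_iff[OF nonneg, of x] by auto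
  qed
  also have "\<dots> \<longleftrightarrow> density N p = density N (\<lambda>_. 1)"
    by (intro density_unique_iff[symmetric]) auto
  finally show ?thesis
    by (simp add: density_1)
qed

text \<open>Both sides integrate \<open>g\<close> against the image law under \<open>A\<close>, so a
  function of the marginal alone can be integrated with the marginal density.\<close>

lemma nn_integral_marginal_density:
  fixes p :: "'b \<Rightarrow> real" and p' :: "'c \<Rightarrow> real" and g :: "'c \<Rightarrow> ennreal"
  assumes [measurable]: "p \<in> borel_measurable N" "p' \<in> borel_measurable N'"
    "A \<in> measurable N N'" "g \<in> borel_measurable N'"
    and marginal: "distr (density N p) N' A = density N' p'"
  shows "(\<integral>\<^sup>+x. p x * g (A x) \<partial>N) = (\<integral>\<^sup>+y. p' y * g y \<partial>N')"
proof -
  have "(\<integral>\<^sup>+x. p x * g (A x) \<partial>N) = (\<integral>\<^sup>+y. g y \<partial>distr (density N p) N' A)"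
    by (simp add: nn_integral_distr nn_integral_density)
  also have "\<dots> = (\<integral>\<^sup>+y. p' y * g y \<partial>N')"
    unfolding marginal by (simp add: nn_integral_density)
  finally show ?thesis .
qed

text \<open>The zero set of \<open>p'\<close> has mass 0 under the marginal, so its preimage under
  \<open>A\<close> has mass 0 under \<open>p\<close>. This provides the condition
  \<open>q = 0 \<Longrightarrow> p = 0\<close> of the tangent inequality when \<open>q\<close> is a
  product of marginal densities.\<close>

lemma AE_marginal_density_eq_0:
  fixes p :: "'b \<Rightarrow> real" and p' :: "'c \<Rightarrow> real"
  assumes [measurable]: "p \<in> borel_measurable N" "p' \<in> borel_measurable N'"
    "A \<in> measurable N N'"
    and nonneg: "\<And>x. p x \<ge> 0"
    and marginal: "distr (density N p) N' A = density N' p'"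
  shows "AE x in N. p' (A x) = 0 \<longrightarrow> p x = 0"
proof -
  define Z where "Z = {y \<in> space N'. p' y = 0}"
  have [measurable]: "Z \<in> sets N'"
    unfolding Z_def by measurable
  have "(\<integral>\<^sup>+x. ennreal (p x) * indicator Z (A x) \<partial>N) = (\<integral>\<^sup>+y. ennreal (p' y) * indicator Z y \<partial>N')"
    by (rule nn_integral_marginal_density) (use marginal in auto)
  also have "\<dots> = (\<integral>\<^sup>+y. 0 \<partial>N')"
    by (intro nn_integral_cong) (auto simp: Z_def indicator_def)
  finally have "AE x in N. ennreal (p x) * indicator Z (A x) = 0"
    by (simp add: nn_integral_0_iff_AE)
  then show ?thesis
    using AE_space
  proof eventually_elim
    case (elim x)
    have "A x \<in> space N'"
      by (rule measurable_space[OF assms(3) elim(2)])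
    then show ?case
      using elim nonneg[of x] by (auto simp: Z_def indicator_def ennreal_eq_0_iff split: if_splits)
  qed
qed

text \<open>The integral of \<open>p * ln p\<close> is split into its positive and negative parts, of which the
  latter is at most 1.\<close>

lemma relative_entropy_parts:
  fixes p :: "'b \<Rightarrow> real"
  assumes "prob_space N" and [measurable]: "p \<in> borel_measurable N"
    and nonneg: "\<And>x. p x \<ge> 0" and "prob_space (density N p)"
  shows "(\<integral>\<^sup>+x. ennreal (p x) * ennreal (ln (p x)) \<partial>N) =
      relative_entropy N p + (\<integral>\<^sup>+x. ennreal (p x) * ennreal (- ln (p x)) \<partial>N)" (is "?P = _ + ?N")
    and "(\<integral>\<^sup>+x. ennreal (p x) * ennreal (- ln (p x)) \<partial>N) \<noteq> \<infinity>"
proof -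
  interpret prob_space N by fact
  interpret P: prob_space "density N p" by fact
  have one: "(\<integral>\<^sup>+x. ennreal (p x) \<partial>N) = 1"
    using P.emeasure_space_1 by (simp add: emeasure_density cong: nn_integral_cong)
  have tangent: "p x * ln (p x) - p x + 1 \<ge> 0" for x
    using mult_ln_ge_tangent[of "p x" 1] nonneg by simp
  \<comment> \<open>Pointwise, the tangent inequality gives
    \<open>- p ln p \<le> 1 - p \<le> 1\<close>.\<close>
  have "?N \<le> (\<integral>\<^sup>+x. 1 \<partial>N)"
  proof (rule nn_integral_mono)
    fix x
    have "ennreal (p x) * ennreal (- ln (p x)) = ennreal (p x * (- ln (p x)))"
      using nonneg by (rule ennreal_mult'[symmetric])
    also have "\<dots> \<le> ennreal 1"
      using tangent[of x] nonneg[of x] by (intro ennreal_leI) linarith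
    finally show "ennreal (p x) * ennreal (- ln (p x)) \<le> 1" by simp
  qed
  then show "?N \<noteq> \<infinity>"
    by (auto simp: emeasure_space_1 top_unique)
  \<comment> \<open>The identity \<open>p ln p + 1 = (p ln p - p + 1) + p\<close>, arranged so that
    every integrand is nonnegative. The added 1 is matched by the integral of \<open>p\<close> and
    cancels at the end.\<close>
  have "?P + 1 = (\<integral>\<^sup>+x. ennreal (p x) * ennreal (ln (p x)) + 1 \<partial>N)"
    by (subst nn_integral_add) (auto simp: emeasure_space_1)
  also have "\<dots> = (\<integral>\<^sup>+x. ennreal (p x * ln (p x) - p x + 1) +
      (ennreal (p x) * ennreal (- ln (p x)) + ennreal (p x)) \<partial>N)"
  proof (rule nn_integral_cong)
    fix x
    show "ennreal (p x) * ennreal (ln (p x)) + 1 = ennreal (p x * ln (p x) - p x + 1) +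
      (ennreal (p x) * ennreal (- ln (p x)) + ennreal (p x))"
    proof (cases "ln (p x) \<ge> 0")
      case True
      then have "p x * ln (p x) \<ge> 0" "ennreal (- ln (p x)) = 0"
        using nonneg by (auto simp: ennreal_neg)
      with True show ?thesis
        using tangent[of x] nonneg[of x]
        by (simp flip: ennreal_mult ennreal_plus ennreal_1)
    next
      case False
      then have "p x * ln (p x) \<le> 0" "ennreal (ln (p x)) = 0"
        using nonneg by (auto simp: ennreal_neg mult_nonneg_nonpos)
      with False show ?thesis
        using tangent[of x] nonneg[of x]
        by (simp flip: ennreal_mult ennreal_plus ennreal_1)
    qed
  qed
  also have "\<dots> = relative_entropy N p + (?N + 1)"
    by (simp add: nn_integral_add one relative_entropy_def)
  finally have "1 + ?P = 1 + (relative_entropy N p + ?N)"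
    by (simp add: ac_simps)
  then show "?P = relative_entropy N p + ?N"
    by (simp add: ennreal_add_left_cancel)
qed

text \<open>With \<open>q\<close> the product of the two marginal densities, the tangent inequality
  \<open>p ln p - p \<ge> p ln q - q\<close> integrates to the claim. The negative parts of the logarithms are moved
  to the other side so that only nonnegative functions are integrated.\<close>

lemma relative_entropy_superadditive:
  fixes p :: "'b \<Rightarrow> real" and p1 :: "'c \<Rightarrow> real" and p2 :: "'d \<Rightarrow> real"
  assumes N: "prob_space N" "prob_space N1" "prob_space N2"
    and [measurable]: "p \<in> borel_measurable N" "p1 \<in> borel_measurable N1"
      "p2 \<in> borel_measurable N2" "A \<in> measurable N N1" "B \<in> measurable N N2"
    and indep: "distr N (N1 \<Otimes>\<^sub>M N2) (\<lambda>x. (A x, B x)) = N1 \<Otimes>\<^sub>M N2"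
    and nonneg: "\<And>x. p x \<ge> 0" "\<And>x. p1 x \<ge> 0" "\<And>x. p2 x \<ge> 0"
    and prob: "prob_space (density N p)"
    and marginal1: "distr (density N p) N1 A = density N1 p1"
    and marginal2: "distr (density N p) N2 B = density N2 p2"
  shows "relative_entropy N1 p1 + relative_entropy N2 p2 \<le> relative_entropy N p"
proof -
  interpret N: prob_space N by fact
  interpret N1: prob_space N1 by fact
  interpret N2: prob_space N2 by fact
  interpret P: prob_space "density N p" by fact
  have prob1: "prob_space (density N1 p1)"
    unfolding marginal1[symmetric] by (rule P.prob_space_distr) simp
  have prob2: "prob_space (density N2 p2)"
    unfolding marginal2[symmetric] by (rule P.prob_space_distr) simp
  have one: "(\<integral>\<^sup>+x. ennreal (p1 x) \<partial>N1) = 1" "(\<integral>\<^sup>+x. ennreal (p2 x) \<partial>N2) = 1"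
    using prob_space.emeasure_space_1[OF prob1] prob_space.emeasure_space_1[OF prob2]
    by (simp_all add: emeasure_density cong: nn_integral_cong)
  \<comment> \<open>By \<open>indep\<close>, the product of the marginal densities factorises under
    \<open>N\<close> and is again a probability density.\<close>
  have "(\<integral>\<^sup>+x. ennreal (p1 (A x)) * ennreal (p2 (B x)) \<partial>N) =
      (\<integral>\<^sup>+z. ennreal (p1 (fst z)) * ennreal (p2 (snd z)) \<partial>distr N (N1 \<Otimes>\<^sub>M N2) (\<lambda>x. (A x, B x)))"
    by (subst nn_integral_distr) auto
  also have "\<dots> = (\<integral>\<^sup>+x. (\<integral>\<^sup>+y. ennreal (p1 x) * ennreal (p2 y) \<partial>N2) \<partial>N1)"
    unfolding indep by (subst N2.nn_integral_fst[symmetric]) auto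
  also have "\<dots> = 1"
    by (simp add: nn_integral_cmult one)
  finally have q: "(\<integral>\<^sup>+x. ennreal (p1 (A x)) * ennreal (p2 (B x)) \<partial>N) = 1" .
  let ?P1 = "\<integral>\<^sup>+y. ennreal (p1 y) * ennreal (ln (p1 y)) \<partial>N1"
  let ?N1 = "\<integral>\<^sup>+y. ennreal (p1 y) * ennreal (- ln (p1 y)) \<partial>N1"
  let ?P2 = "\<integral>\<^sup>+y. ennreal (p2 y) * ennreal (ln (p2 y)) \<partial>N2"
  let ?N2 = "\<integral>\<^sup>+y. ennreal (p2 y) * ennreal (- ln (p2 y)) \<partial>N2"
  have marg1: "(\<integral>\<^sup>+x. ennreal (p x) * ennreal (g (p1 (A x))) \<partial>N) =
      (\<integral>\<^sup>+y. ennreal (p1 y) * ennreal (g (p1 y)) \<partial>N1)"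
    if [measurable]: "g \<in> borel_measurable borel" for g :: "real \<Rightarrow> real"
    by (rule nn_integral_marginal_density[where g = "\<lambda>y. ennreal (g (p1 y))"]) (use marginal1 in auto)
  have marg2: "(\<integral>\<^sup>+x. ennreal (p x) * ennreal (g (p2 (B x))) \<partial>N) =
      (\<integral>\<^sup>+y. ennreal (p2 y) * ennreal (g (p2 y)) \<partial>N2)"
    if [measurable]: "g \<in> borel_measurable borel" for g :: "real \<Rightarrow> real"
    by (rule nn_integral_marginal_density[where g = "\<lambda>y. ennreal (g (p2 y))"]) (use marginal2 in auto)
  \<comment> \<open>The 1 completes the integrand \<open>p ln p - p + 1\<close> of the relative
    entropy; it is balanced by the integral 1 of the product density.\<close>
  have "1 + (?P1 + ?P2) = (\<integral>\<^sup>+x. 1 + (ennreal (p x) * ennreal (ln (p1 (A x))) +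
      ennreal (p x) * ennreal (ln (p2 (B x)))) \<partial>N)"
    by (simp add: nn_integral_add N.emeasure_space_1 marg1 marg2)
  also have "\<dots> \<le> (\<integral>\<^sup>+x. ennreal (p x * ln (p x) - p x + 1) + ennreal (p1 (A x)) * ennreal (p2 (B x)) +
      (ennreal (p x) * ennreal (- ln (p1 (A x))) + ennreal (p x) * ennreal (- ln (p2 (B x)))) \<partial>N)"
    (is "_ \<le> integral\<^sup>N N ?r")
  proof (rule nn_integral_mono_AE)
    have "AE x in N. p1 (A x) = 0 \<longrightarrow> p x = 0" "AE x in N. p2 (B x) = 0 \<longrightarrow> p x = 0"
      by (rule AE_marginal_density_eq_0; use marginal1 marginal2 nonneg in auto)+
    then show "AE x in N. 1 + (ennreal (p x) * ennreal (ln (p1 (A x))) +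
      ennreal (p x) * ennreal (ln (p2 (B x)))) \<le> ?r x"
    proof eventually_elim
      case (elim x)
      define s t u v w where "s = p x" and "t = p1 (A x)" and "u = p2 (B x)"
        and "v = s * ln t" and "w = s * ln u"
      have nn: "s \<ge> 0" "t \<ge> 0" "u \<ge> 0"
        using nonneg by (auto simp: s_def t_def u_def)
      have "s * ln (t * u) - t * u \<le> s * ln s - s"
        by (rule mult_ln_ge_tangent) (use nn elim in \<open>auto simp: s_def t_def u_def\<close>)
      \<comment> \<open>Additivity of \<open>ln\<close> is used for positive \<open>t\<close> and
        \<open>u\<close> only; if either is 0, so is \<open>s\<close>.\<close>
      moreover have "s * ln (t * u) = v + w"
      proof (cases "s = 0")
        case False
        then have "t > 0" "u > 0"
          using nn elim by (auto simp: s_def t_def u_def less_le)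
        then show ?thesis
          by (simp add: ln_mult v_def w_def algebra_simps)
      qed (simp add: v_def w_def)
      ultimately have ineq: "v + w \<le> s * ln s - s + t * u"
        by simp
      have tangent: "s * ln s - s + 1 \<ge> 0"
        using mult_ln_ge_tangent[of s 1] nn by simp
      have *: "ennreal s * ennreal z = ennreal (max 0 (s * z))" for z
        using nn by (cases "z \<ge> 0") (auto simp: ennreal_mult ennreal_neg mult_nonneg_nonpos max_def)
      have "ennreal (1 + (max 0 v + max 0 w)) \<le>
        ennreal ((s * ln s - s + 1) + t * u + (max 0 (- v) + max 0 (- w)))"
        using ineq by (intro ennreal_leI) (auto simp: max_def)
      then have "1 + (ennreal s * ennreal (ln t) + ennreal s * ennreal (ln u)) \<le>
        ennreal (s * ln s - s + 1) + ennreal t * ennreal u +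
        (ennreal s * ennreal (- ln t) + ennreal s * ennreal (- ln u))"
        using nn tangent by (simp add: * ennreal_mult flip: v_def w_def)
      then show ?case
        by (simp add: s_def t_def u_def)
    qed
  qed
  also have "\<dots> = relative_entropy N p + 1 + (?N1 + ?N2)"
    by (simp add: nn_integral_add q marg1[of "\<lambda>z. - ln z"] marg2[of "\<lambda>z. - ln z"] relative_entropy_def)
  finally have "1 + (?P1 + ?P2) \<le> 1 + (relative_entropy N p + (?N1 + ?N2))"
    by (simp add: ac_simps)
  then have "?P1 + ?P2 \<le> relative_entropy N p + (?N1 + ?N2)"
    by (simp add: ennreal_add_left_cancel_le)
  \<comment> \<open>\<open>?P1\<close> and \<open>?P2\<close> are replaced by relative entropy plus
    negative part; the negative parts are finite and hence can be cancelled.\<close>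
  then have "(?N1 + ?N2) + (relative_entropy N1 p1 + relative_entropy N2 p2)
    \<le> (?N1 + ?N2) + relative_entropy N p"
    using relative_entropy_parts(1)[OF N(2) _ nonneg(2) prob1]
      relative_entropy_parts(1)[OF N(3) _ nonneg(3) prob2]
    by (simp add: ac_simps)
  then show ?thesis
    using relative_entropy_parts(2)[OF N(2) _ nonneg(2) prob1]
      relative_entropy_parts(2)[OF N(3) _ nonneg(3) prob2]
    by (simp add: ennreal_add_left_cancel_le)
qed

section \<open>Entropy with respect to a reference measure in terms of relative entropy\<close>

text \<open>The relative entropy with respect to the density \<open>exp (- V)\<close> is \<open>\<integral> f ln f + \<integral> f V\<close>; the bound
  \<open>psi f \<le> f V + exp (- V)\<close> excludes the undefined case \<open>\<infinity> - \<infinity>\<close>.\<close>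

lemma ext_integral_psi_eq:
  fixes f V :: "'b \<Rightarrow> real"
  assumes [measurable]: "f \<in> borel_measurable N" "V \<in> borel_measurable N"
    and nonneg: "\<And>x. f x \<ge> 0" "\<And>x. V x \<ge> 0"
    and one: "(\<integral>\<^sup>+x. ennreal (f x) \<partial>N) = 1" "(\<integral>\<^sup>+x. ennreal (exp (- V x)) \<partial>N) = 1"
    and cross: "(\<integral>\<^sup>+x. ennreal (f x * V x) \<partial>N) = ennreal c" and "c \<ge> 0"
  shows "ext_integral N (\<lambda>x. psi (f x)) = ereal c -
    enn2ereal (relative_entropy (density N (\<lambda>x. ennreal (exp (- V x)))) (\<lambda>x. f x / exp (- V x)))"
    (is "_ = _ - enn2ereal ?K")
proof -
  have psi_eq: "psi (f x) = - (f x * ln (f x))" for x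
    using nonneg(1)[of x] by (auto simp: psi_def less_le)
  \<comment> \<open>\<open>exp (- V)\<close> times the relative entropy integrand at
    \<open>f / exp (- V)\<close>. It is nonnegative by the tangent inequality with
    \<open>q = exp (- V x)\<close>.\<close>
  define k where "k x = f x * ln (f x) + f x * V x - f x + exp (- V x)" for x
  have k_nonneg: "k x \<ge> 0" for x
    using mult_ln_ge_tangent[of "f x" "exp (- V x)"] nonneg(1)[of x] by (simp add: k_def)
  have [measurable]: "k \<in> borel_measurable N"
    unfolding k_def by measurable
  have "?K = (\<integral>\<^sup>+x. ennreal (k x) \<partial>N)"
    unfolding relative_entropy_def
  proof (subst nn_integral_density, measurable, rule nn_integral_cong)
    fix x
    have "f x / exp (- V x) * ln (f x / exp (- V x)) - f x / exp (- V x) + 1 = k x / exp (- V x)"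
    proof (cases "f x = 0")
      case False
      then have "f x > 0"
        using nonneg(1)[of x] by (simp add: less_le)
      then have "ln (f x / exp (- V x)) = ln (f x) + V x"
        by (subst ln_div) auto
      then show ?thesis
        by (simp add: k_def field_simps)
    qed (simp add: k_def)
    then show "ennreal (exp (- V x)) * ennreal (f x / exp (- V x) * ln (f x / exp (- V x)) -
      f x / exp (- V x) + 1) = ennreal (k x)"
      using k_nonneg[of x] by (simp flip: ennreal_mult)
  qed
  let ?Hp = "\<integral>\<^sup>+x. ennreal (psi (f x)) \<partial>N" and ?Hn = "\<integral>\<^sup>+x. ennreal (- psi (f x)) \<partial>N"
  have [measurable]: "(\<lambda>x. psi (f x)) \<in> borel_measurable N"
    unfolding psi_eq by measurable
  \<comment> \<open>Pointwise \<open>k + f + psi f = f V + exp (- V)\<close>, with the negative part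
    of \<open>psi f\<close> moved to the right so that all terms are nonnegative.\<close>
  have "?K + 1 + ?Hp = (\<integral>\<^sup>+x. ennreal (k x) + ennreal (f x) + ennreal (psi (f x)) \<partial>N)"
    using \<open>?K = _\<close> by (simp add: nn_integral_add one)
  also have "\<dots> = (\<integral>\<^sup>+x. ennreal (- psi (f x)) + ennreal (f x * V x) + ennreal (exp (- V x)) \<partial>N)"
  proof (rule nn_integral_cong)
    fix x
    have fV: "f x * V x \<ge> 0"
      using nonneg by simp
    show "ennreal (k x) + ennreal (f x) + ennreal (psi (f x)) =
      ennreal (- psi (f x)) + ennreal (f x * V x) + ennreal (exp (- V x))"
    proof (cases "psi (f x) \<ge> 0")
      case True
      then have "ennreal (- psi (f x)) = 0"
        by (simp add: ennreal_neg)
      then show ?thesis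
        using True k_nonneg[of x] nonneg(1)[of x] fV
        by (simp flip: ennreal_plus) (simp add: k_def psi_eq)
    next
      case False
      then have "ennreal (psi (f x)) = 0"
        by (simp add: ennreal_neg)
      then show ?thesis
        using False k_nonneg[of x] nonneg(1)[of x] fV
        by (simp flip: ennreal_plus) (simp add: k_def psi_eq)
    qed
  qed
  also have "\<dots> = ?Hn + ennreal c + 1"
    by (simp add: nn_integral_add one cross)
  finally have "1 + (?K + ?Hp) = 1 + (?Hn + ennreal c)"
    by (simp add: ac_simps)
  then have balance: "?K + ?Hp = ?Hn + ennreal c"
    by (simp add: ennreal_add_left_cancel)
  have "?Hp \<le> (\<integral>\<^sup>+x. ennreal (f x * V x) + ennreal (exp (- V x)) \<partial>N)"
  proof (rule nn_integral_mono)
    fix x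
    have "psi (f x) \<le> f x * V x + exp (- V x)"
      using k_nonneg[of x] nonneg(1)[of x] by (simp add: k_def psi_eq)
    then show "ennreal (psi (f x)) \<le> ennreal (f x * V x) + ennreal (exp (- V x))"
      using nonneg by (simp flip: ennreal_plus add: ennreal_leI)
  qed
  also have "\<dots> = ennreal c + 1"
    by (simp add: nn_integral_add one cross)
  finally have "?Hp \<noteq> \<infinity>"
    by (auto simp: top_unique)
  then obtain h where h: "?Hp = ennreal h" "h \<ge> 0"
    by (cases ?Hp) auto
  \<comment> \<open>Since \<open>?Hp\<close> and \<open>c\<close> are finite, \<open>balance\<close>
    makes \<open>?Hn\<close> and \<open>?K\<close> finite or infinite together.\<close>
  show ?thesis
  proof (cases ?Hn)
    case (real r)
    then have "?K \<noteq> \<infinity>"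
      using balance h \<open>c \<ge> 0\<close> by (auto simp flip: ennreal_plus)
    then obtain s where s: "?K = ennreal s" "s \<ge> 0"
      by (cases ?K) auto
    then have "s + h = r + c"
      using balance h real \<open>c \<ge> 0\<close> by (simp flip: ennreal_plus)
    then show ?thesis
      using s h real by (simp add: ext_integral_def enn2ereal_ennreal)
  next
    case top
    then have "?K = \<infinity>"
      using balance h by (cases ?K) (auto simp flip: ennreal_plus)
    then show ?thesis
      using top h by (simp add: ext_integral_def enn2ereal_ennreal)
  qed
qed

section \<open>Finite product measures: densities and splitting of coordinates\<close>

text \<open>A product measure is determined by its values on boxes, and the indicator of a box
  factorises just as the density does, so the integral becomes a product of one-dimensional
  ones.\<close>

lemma PiM_density:
  fixes f :: "'i \<Rightarrow> 'b \<Rightarrow> ennreal"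
  assumes "finite I" "product_sigma_finite N" "product_sigma_finite (\<lambda>i. density (N i) (f i))"
    and [measurable]: "\<And>i. f i \<in> borel_measurable (N i)"
  shows "PiM I (\<lambda>i. density (N i) (f i)) = density (PiM I N) (\<lambda>x. \<Prod>i\<in>I. f i (x i))"
proof (rule product_sigma_finite.PiM_eqI[OF assms(3) \<open>finite I\<close>, symmetric])
  interpret product_sigma_finite N by fact
  show "sets (density (PiM I N) (\<lambda>x. \<Prod>i\<in>I. f i (x i))) = sets (PiM I (\<lambda>i. density (N i) (f i)))"
    by (auto intro!: sets_PiM_cong)
  fix A assume "\<And>i. i \<in> I \<Longrightarrow> A i \<in> sets (density (N i) (f i))"
  then have [measurable]: "\<And>i. i \<in> I \<Longrightarrow> A i \<in> sets (N i)"
    by simp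
  have "emeasure (density (PiM I N) (\<lambda>x. \<Prod>i\<in>I. f i (x i))) (Pi\<^sub>E I A) =
      (\<integral>\<^sup>+x. (\<Prod>i\<in>I. f i (x i)) * indicator (Pi\<^sub>E I A) x \<partial>PiM I N)"
    using \<open>finite I\<close> by (intro emeasure_density sets_PiM_I_finite) auto
  also have "\<dots> = (\<integral>\<^sup>+x. (\<Prod>i\<in>I. f i (x i) * indicator (A i) (x i)) \<partial>PiM I N)"
  proof (rule nn_integral_cong)
    fix x assume "x \<in> space (PiM I N)"
    then have "indicator (Pi\<^sub>E I A) x = (\<Prod>i\<in>I. indicator (A i) (x i) :: ennreal)"
      using \<open>finite I\<close> by (auto simp: indicator_def space_PiM PiE_iff)
    then show "(\<Prod>i\<in>I. f i (x i)) * indicator (Pi\<^sub>E I A) x = (\<Prod>i\<in>I. f i (x i) * indicator (A i) (x i))"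
      by (simp add: prod.distrib)
  qed
  also have "\<dots> = (\<Prod>i\<in>I. \<integral>\<^sup>+y. f i y * indicator (A i) y \<partial>N i)"
    by (rule product_nn_integral_prod[OF \<open>finite I\<close>]) auto
  also have "\<dots> = (\<Prod>i\<in>I. emeasure (density (N i) (f i)) (A i))"
    by (intro prod.cong) (auto simp: emeasure_density)
  finally show "emeasure (density (PiM I N) (\<lambda>x. \<Prod>i\<in>I. f i (x i))) (Pi\<^sub>E I A) =
      (\<Prod>i\<in>I. emeasure (density (N i) (f i)) (A i))" .
qed

text \<open>The inverse map \<open>app\<close>, which concatenates two blocks, pulls boxes back to
  products of boxes and therefore carries the pair measure to the product over
  \<open>{..<m + n}\<close>. Splitting undoes \<open>app\<close>. For a probability measure this is
  the independence of the two blocks.\<close>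

lemma distr_PiM_split:
  fixes m n :: nat
  assumes "sigma_finite_measure N"
  shows "distr (PiM {..<m + n} (\<lambda>_. N)) (PiM {..<m} (\<lambda>_. N) \<Otimes>\<^sub>M PiM {..<n} (\<lambda>_. N))
      (\<lambda>x. (restrict x {..<m}, \<lambda>i\<in>{..<n}. x (m + i))) =
    PiM {..<m} (\<lambda>_. N) \<Otimes>\<^sub>M PiM {..<n} (\<lambda>_. N)" (is "distr _ ?Q ?split = _")
proof -
  interpret product_sigma_finite "\<lambda>_::nat. N"
    using assms by (simp add: product_sigma_finite_def)
  interpret Pm: finite_product_sigma_finite "\<lambda>_::nat. N" "{..<m}"
    by standard simp
  interpret Pn: finite_product_sigma_finite "\<lambda>_::nat. N" "{..<n}"
    by standard simp
  define app where "app = (\<lambda>(x :: nat \<Rightarrow> 'a, y). \<lambda>i\<in>{..<m + n}. if i < m then x i else y (i - m))"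
  have [measurable]: "app \<in> measurable ?Q (PiM {..<m + n} (\<lambda>_. N))"
    unfolding app_def split_beta'
  proof (rule measurable_restrict)
    fix i assume "i \<in> {..<m + n}"
    then show "(\<lambda>z. if i < m then fst z i else snd z (i - m)) \<in> measurable ?Q N"
      by (cases "i < m") (auto intro!: measurable_component_singleton
          measurable_compose[OF measurable_fst] measurable_compose[OF measurable_snd])
  qed
  have [measurable]: "?split \<in> measurable (PiM {..<m + n} (\<lambda>_. N)) ?Q"
    by (intro measurable_Pair measurable_restrict measurable_component_singleton) auto
  have "distr ?Q (PiM {..<m + n} (\<lambda>_. N)) app = PiM {..<m + n} (\<lambda>_. N)"
  proof (rule PiM_eqI)
    fix A :: "nat \<Rightarrow> 'a set" assume "\<And>i. i \<in> {..<m + n} \<Longrightarrow> A i \<in> sets N"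
    then have A: "\<And>i. i < m + n \<Longrightarrow> A i \<in> sets N"
      by simp
    have "app -` Pi\<^sub>E {..<m + n} A \<inter> space ?Q =
        Pi\<^sub>E {..<m} A \<times> Pi\<^sub>E {..<n} (\<lambda>i. A (m + i))" (is "?L = ?R")
    proof (rule set_eqI)
      fix z :: "(nat \<Rightarrow> 'a) \<times> (nat \<Rightarrow> 'a)"
      obtain x y where z: "z = (x, y)" by fastforce
      have sub: "A i \<subseteq> space N" if "i < m + n" for i
        using A[OF that] by (rule sets.sets_into_space)
      have iff: "(\<forall>i<m + n. (if i < m then x i else y (i - m)) \<in> A i) \<longleftrightarrow>
          (\<forall>i<m. x i \<in> A i) \<and> (\<forall>i<n. y i \<in> A (m + i))"
      proof (intro iffI conjI allI impI)
        fix i assume *: "\<forall>i<m + n. (if i < m then x i else y (i - m)) \<in> A i"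
        show "x i \<in> A i" if "i < m"
          using *[rule_format, of i] that by simp
        show "y i \<in> A (m + i)" if "i < n"
          using *[rule_format, of "m + i"] that by simp
      next
        fix i assume *: "(\<forall>i<m. x i \<in> A i) \<and> (\<forall>i<n. y i \<in> A (m + i))" and "i < m + n"
        then show "(if i < m then x i else y (i - m)) \<in> A i"
          using *[THEN conjunct2, rule_format, of "i - m"] by (cases "i < m") simp_all
      qed
      have "x i \<in> space N" if "x i \<in> A i" "i < m" for i
        using sub[of i] that by auto
      moreover have "y i \<in> space N" if "y i \<in> A (m + i)" "i < n" for i
        using sub[of "m + i"] that by auto
      moreover have "z \<in> ?L \<longleftrightarrow> x \<in> extensional {..<m} \<and> y \<in> extensional {..<n} \<and>
          (\<forall>i<m. x i \<in> space N) \<and> (\<forall>i<n. y i \<in> space N) \<and>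
          (\<forall>i<m + n. (if i < m then x i else y (i - m)) \<in> A i)"
        by (auto simp: z app_def space_pair_measure space_PiM PiE_iff Ball_def)
      ultimately show "z \<in> ?L \<longleftrightarrow> z \<in> ?R"
        unfolding iff by (auto simp: z PiE_iff)
    qed
    then have "emeasure (distr ?Q (PiM {..<m + n} (\<lambda>_. N)) app) (Pi\<^sub>E {..<m + n} A) =
        emeasure ?Q (Pi\<^sub>E {..<m} A \<times> Pi\<^sub>E {..<n} (\<lambda>i. A (m + i)))"
      using A by (subst emeasure_distr) (auto intro!: sets_PiM_I_finite)
    also have "\<dots> = (\<Prod>i<m. emeasure N (A i)) * (\<Prod>i<n. emeasure N (A (m + i)))"
    proof -
      have "emeasure (PiM {..<m} (\<lambda>_. N)) (Pi\<^sub>E {..<m} A) = (\<Prod>i<m. emeasure N (A i))"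
        using A by (intro Pm.measure_times) auto
      moreover have "emeasure (PiM {..<n} (\<lambda>_. N)) (Pi\<^sub>E {..<n} (\<lambda>i. A (m + i))) =
          (\<Prod>i<n. emeasure N (A (m + i)))"
        using A by (intro Pn.measure_times) auto
      ultimately show ?thesis
        using A by (subst Pn.emeasure_pair_measure_Times) (auto intro!: sets_PiM_I_finite)
    qed
    also have "\<dots> = (\<Prod>i<m + n. emeasure N (A i))"
      by (induction n) (auto simp flip: mult.assoc)
    finally show "emeasure (distr ?Q (PiM {..<m + n} (\<lambda>_. N)) app) (Pi\<^sub>E {..<m + n} A) =
        (\<Prod>i\<in>{..<m + n}. emeasure N (A i))" .
  qed auto
  then have "distr (PiM {..<m + n} (\<lambda>_. N)) ?Q ?split = distr ?Q ?Q (?split \<circ> app)"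
    by (metis (no_types, lifting) \<open>app \<in> _\<close> \<open>?split \<in> _\<close> distr_distr)
  also have "\<dots> = distr ?Q ?Q (\<lambda>z. z)"
  proof (rule distr_cong)
    fix z assume "z \<in> space ?Q"
    then show "(?split \<circ> app) z = z"
      by (cases z) (auto simp: app_def space_pair_measure space_PiM PiE_iff extensional_def fun_eq_iff)
  qed auto
  finally show ?thesis
    by (simp add: distr_id2)
qed

section \<open>The standard Gaussian measure as a density\<close>

text \<open>Minus the logarithm of the Gaussian density. It serves as the function \<open>V\<close>
  of \<open>ext_integral_psi_eq\<close>, which has to be nonnegative; this holds because
  \<open>2 * pi \<ge> 1\<close>.\<close>

definition gauss_exponent :: "nat \<Rightarrow> (nat \<Rightarrow> real) \<Rightarrow> real" where
  "gauss_exponent n x = (\<Sum>i<n. ln (2 * pi) / 2 + (x i)\<^sup>2 / 2)"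

lemma gauss_exponent_nonneg: "gauss_exponent n x \<ge> 0"
proof -
  have "1 \<le> 2 * pi"
    using pi_ge_two by linarith
  then show ?thesis
    unfolding gauss_exponent_def by (intro sum_nonneg add_nonneg_nonneg) auto
qed

lemma std_normal_density_eq_exp: "std_normal_density x = exp (- (ln (2 * pi) / 2 + x\<^sup>2 / 2))"
proof -
  have "sqrt (2 * pi) = exp (ln (2 * pi) / 2)"
    by (simp add: ln_sqrt[symmetric])
  moreover have "exp (- (ln (2 * pi) / 2 + x\<^sup>2 / 2)) = inverse (exp (ln (2 * pi) / 2)) * exp (- (x\<^sup>2 / 2))"
    by (simp only: minus_add_distrib exp_add exp_minus)
  ultimately show ?thesis
    by (simp add: std_normal_density_def inverse_eq_divide)
qed

lemma sigma_finite_leb: "sigma_finite_measure (leb n)"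
proof -
  interpret product_sigma_finite "\<lambda>_::nat. lborel :: real measure"
    by standard
  interpret finite_product_sigma_finite "\<lambda>_::nat. lborel :: real measure" "{..<n}"
    by standard simp
  show ?thesis
    unfolding leb_def by unfold_locales
qed

lemma prob_space_std_gauss: "prob_space (std_gauss n)"
  unfolding std_gauss_def by (intro prob_space_PiM prob_space_normal_density) simp

lemma sets_leb: "sets (leb n) = sets (PiM {..<n} (\<lambda>_. borel))"
  unfolding leb_def by (intro sets_PiM_cong) auto

lemma sets_std_gauss: "sets (std_gauss n) = sets (PiM {..<n} (\<lambda>_. borel))"
  unfolding std_gauss_def by (intro sets_PiM_cong) auto

lemma borel_measurable_gauss_exponent [measurable]: "gauss_exponent n \<in> borel_measurable (leb n)"
  unfolding gauss_exponent_def leb_def by measurable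

lemma std_gauss_eq_density: "std_gauss n = density (leb n) (\<lambda>x. ennreal (exp (- gauss_exponent n x)))"
proof -
  have "std_gauss n = density (leb n) (\<lambda>x. \<Prod>i<n. ennreal (std_normal_density (x i)))"
    unfolding std_gauss_def leb_def
    by (rule PiM_density)
      (auto simp: product_sigma_finite_def sigma_finite_lborel
        intro!: prob_space_imp_sigma_finite prob_space_normal_density)
  also have "(\<lambda>x. \<Prod>i<n. ennreal (std_normal_density (x i))) =
      (\<lambda>x. ennreal (exp (- gauss_exponent n x)))"
  proof
    fix x :: "nat \<Rightarrow> real"
    have "(\<Prod>i<n. ennreal (std_normal_density (x i))) = ennreal (\<Prod>i<n. std_normal_density (x i))"
      by (rule prod_ennreal) simp
    also have "(\<Prod>i<n. std_normal_density (x i)) = exp (- gauss_exponent n x)"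
      by (simp add: std_normal_density_eq_exp gauss_exponent_def exp_sum[symmetric] sum_negf[symmetric])
    finally show "(\<Prod>i<n. ennreal (std_normal_density (x i))) = ennreal (exp (- gauss_exponent n x))" .
  qed
  finally show ?thesis .
qed

text \<open>\<open>leb 0\<close> is a unit point mass, so every measure on its sets is absolutely
  continuous. \<open>AC\<close> speaks of \<open>n \<ge> 1\<close> only, whereas the sequence passed
  to Fekete's lemma starts at 0.\<close>

lemma null_sets_leb_0: "null_sets (leb 0) = {{}}"
proof -
  have "emeasure (leb 0) {\<lambda>_. undefined} = 1"
    by (simp add: leb_def)
  then show ?thesis
    unfolding null_sets_def by (auto simp: leb_def sets_PiM_empty)
qed

section \<open>Orbit laws, their densities and their relative entropies\<close>

locale AC_process = dynamical_system M T for M :: "'a measure" and T :: "'a \<Rightarrow> 'a" +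
  fixes F :: "'a \<Rightarrow> real"
  assumes AC: "F \<in> AC M T"
begin

lemma measurable_F [measurable]: "F \<in> borel_measurable M"
  using AC by (simp add: AC_def L2_functions_def)

lemma measurable_funpow_T [measurable]: "T ^^ i \<in> measurable M M"
  using measurable_T by (induction i) (auto simp: comp_def)

lemma distr_funpow_T: "distr M M (T ^^ i) = M"
proof (induction i)
  case (Suc i)
  have "distr M M (T ^^ Suc i) = distr (distr M M (T ^^ i)) M T"
    using measurable_T by (simp add: distr_distr)
  then show ?case
    by (simp only: Suc.IH measure_preserving_T)
qed (simp add: distr_id2)

lemma measurable_orbit_vec [measurable]:
  "orbit_vec T F n \<in> measurable M (PiM {..<n} (\<lambda>_. borel))"
  unfolding orbit_vec_def by (intro measurable_restrict measurable_compose[OF measurable_funpow_T]) simp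

lemma sets_orbit_law [simp, measurable_cong]:
  "sets (orbit_law M T F n) = sets (PiM {..<n} (\<lambda>_. borel))"
  by (simp add: orbit_law_def)

lemma prob_space_orbit_law: "prob_space (orbit_law M T F n)"
  unfolding orbit_law_def by (rule prob_space_distr) simp

lemma absolutely_continuous_orbit_law: "absolutely_continuous (leb n) (orbit_law M T F n)"
proof (cases "n = 0")
  case True
  then show ?thesis
    by (simp add: absolutely_continuous_def null_sets_leb_0)
qed (use AC in \<open>simp add: AC_def\<close>)

definition orbit_density :: "nat \<Rightarrow> (nat \<Rightarrow> real) \<Rightarrow> real" where
  "orbit_density n x = enn2real (RN_deriv (leb n) (orbit_law M T F n) x)"

lemma borel_measurable_orbit_density [measurable]: "orbit_density n \<in> borel_measurable (leb n)"
  unfolding orbit_density_def by measurable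

lemma density_orbit_density: "density (leb n) (orbit_density n) = orbit_law M T F n"
proof -
  interpret leb: sigma_finite_measure "leb n"
    by (rule sigma_finite_leb)
  have sets: "sets (orbit_law M T F n) = sets (leb n)"
    by (simp add: sets_leb)
  have "density (leb n) (orbit_density n) = density (leb n) (RN_deriv (leb n) (orbit_law M T F n))"
  proof (rule density_cong)
    have "AE x in leb n. RN_deriv (leb n) (orbit_law M T F n) x \<noteq> \<infinity>"
      by (rule leb.RN_deriv_finite[OF _ absolutely_continuous_orbit_law sets])
        (rule prob_space_imp_sigma_finite[OF prob_space_orbit_law])
    then show "AE x in leb n. ennreal (orbit_density n x) = RN_deriv (leb n) (orbit_law M T F n) x"
      by eventually_elim (simp add: orbit_density_def ennreal_enn2real less_top)
  qed auto
  also have "\<dots> = orbit_law M T F n"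
    by (rule leb.density_RN_deriv[OF absolutely_continuous_orbit_law sets])
  finally show ?thesis .
qed

text \<open>A pointwise quotient of densities rather than an \<open>RN_deriv\<close> over
  \<open>std_gauss n\<close>, so that it agrees exactly with the quotient in
  \<open>ext_integral_psi_eq\<close>.\<close>

definition gauss_rel_density :: "nat \<Rightarrow> (nat \<Rightarrow> real) \<Rightarrow> real" where
  "gauss_rel_density n x = orbit_density n x / exp (- gauss_exponent n x)"

lemma gauss_rel_density_nonneg: "gauss_rel_density n x \<ge> 0"
  by (simp add: gauss_rel_density_def orbit_density_def)

lemma borel_measurable_gauss_rel_density [measurable]:
  "gauss_rel_density n \<in> borel_measurable (std_gauss n)"
  unfolding std_gauss_eq_density gauss_rel_density_def by measurable

lemma density_gauss_rel_density: "density (std_gauss n) (gauss_rel_density n) = orbit_law M T F n"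
proof -
  have "density (std_gauss n) (gauss_rel_density n) =
      density (leb n) (\<lambda>x. ennreal (exp (- gauss_exponent n x)) * ennreal (gauss_rel_density n x))"
    unfolding std_gauss_eq_density
    by (rule density_density_eq) (auto simp: gauss_rel_density_def)
  also have "(\<lambda>x. ennreal (exp (- gauss_exponent n x)) * ennreal (gauss_rel_density n x)) =
      (\<lambda>x. ennreal (orbit_density n x))"
    by (auto simp: gauss_rel_density_def orbit_density_def simp flip: ennreal_mult)
  finally show ?thesis
    by (simp add: density_orbit_density)
qed

definition gauss_relative_entropy :: "nat \<Rightarrow> ennreal" where
  "gauss_relative_entropy n = relative_entropy (std_gauss n) (gauss_rel_density n)"

lemma gauss_relative_entropy_eq_0_iff:
  "gauss_relative_entropy n = 0 \<longleftrightarrow> orbit_law M T F n = std_gauss n"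
  unfolding gauss_relative_entropy_def
  by (subst relative_entropy_eq_0_iff)
    (auto simp: density_gauss_rel_density gauss_rel_density_nonneg
      intro: prob_space_imp_sigma_finite prob_space_std_gauss)

lemma orbit_law_restrict:
  "distr (orbit_law M T F (m + n)) (PiM {..<m} (\<lambda>_. borel)) (\<lambda>x. restrict x {..<m}) =
    orbit_law M T F m"
proof -
  have [measurable]: "(\<lambda>x. restrict x {..<m}) \<in>
      measurable (PiM {..<m + n} (\<lambda>_. borel)) (PiM {..<m} (\<lambda>_. borel :: real measure))"
    by (rule measurable_restrict_subset) auto
  show ?thesis
    unfolding orbit_law_def
    by (subst distr_distr, measurable, intro distr_cong) (auto simp: orbit_vec_def restrict_def)
qed

text \<open>Stationarity: the coordinates from \<open>m\<close> on form the orbit vector of length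
  \<open>n\<close> started at \<open>(T ^^ m) \<omega>\<close>, and \<open>T ^^ m\<close> preserves
  \<open>M\<close>.\<close>

lemma orbit_law_shift:
  "distr (orbit_law M T F (m + n)) (PiM {..<n} (\<lambda>_. borel)) (\<lambda>x. \<lambda>i\<in>{..<n}. x (m + i)) =
    orbit_law M T F n"
proof -
  have [measurable]: "(\<lambda>x. \<lambda>i\<in>{..<n}. x (m + i)) \<in>
      measurable (PiM {..<m + n} (\<lambda>_. borel)) (PiM {..<n} (\<lambda>_. borel :: real measure))"
    by (intro measurable_restrict measurable_component_singleton) auto
  have "distr (orbit_law M T F (m + n)) (PiM {..<n} (\<lambda>_. borel)) (\<lambda>x. \<lambda>i\<in>{..<n}. x (m + i)) =
      distr M (PiM {..<n} (\<lambda>_. borel)) (orbit_vec T F n \<circ> (T ^^ m))"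
    unfolding orbit_law_def
  proof (subst distr_distr, measurable, intro distr_cong refl ext)
    fix \<omega> i
    have "(T ^^ (m + i)) \<omega> = (T ^^ i) ((T ^^ m) \<omega>)"
      by (simp add: funpow_add add.commute[of m])
    then show "((\<lambda>x. \<lambda>i\<in>{..<n}. x (m + i)) \<circ> orbit_vec T F (m + n)) \<omega> i =
        (orbit_vec T F n \<circ> (T ^^ m)) \<omega> i"
      by (simp add: orbit_vec_def restrict_def)
  qed
  also have "\<dots> = distr (distr M M (T ^^ m)) (PiM {..<n} (\<lambda>_. borel)) (orbit_vec T F n)"
    by (rule distr_distr[symmetric]) auto
  finally show ?thesis
    by (simp add: distr_funpow_T orbit_law_def)
qed

text \<open>The first \<open>m\<close> and the last \<open>n\<close> coordinates are independent
  under the Gaussian product, and the corresponding marginals of the long orbit law are the orbit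
  laws of lengths \<open>m\<close> and \<open>n\<close>.\<close>

lemma gauss_relative_entropy_superadditive:
  "gauss_relative_entropy m + gauss_relative_entropy n \<le> gauss_relative_entropy (m + n)"
  unfolding gauss_relative_entropy_def
proof (rule relative_entropy_superadditive)
  let ?A = "\<lambda>x :: nat \<Rightarrow> real. restrict x {..<m}"
  let ?B = "\<lambda>x :: nat \<Rightarrow> real. \<lambda>i\<in>{..<n}. x (m + i)"
  show "prob_space (std_gauss (m + n))" "prob_space (std_gauss m)" "prob_space (std_gauss n)"
    by (rule prob_space_std_gauss)+
  show "?A \<in> measurable (std_gauss (m + n)) (std_gauss m)"
    unfolding std_gauss_def by (rule measurable_restrict_subset) auto
  show "?B \<in> measurable (std_gauss (m + n)) (std_gauss n)"
    unfolding std_gauss_def by (intro measurable_restrict measurable_component_singleton) auto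
  show "distr (std_gauss (m + n)) (std_gauss m \<Otimes>\<^sub>M std_gauss n) (\<lambda>x. (?A x, ?B x)) =
      std_gauss m \<Otimes>\<^sub>M std_gauss n"
    unfolding std_gauss_def
    by (intro distr_PiM_split prob_space_imp_sigma_finite prob_space_normal_density) simp
  show "prob_space (density (std_gauss (m + n)) (gauss_rel_density (m + n)))"
    unfolding density_gauss_rel_density by (rule prob_space_orbit_law)
  show "distr (density (std_gauss (m + n)) (gauss_rel_density (m + n))) (std_gauss m) ?A =
      density (std_gauss m) (gauss_rel_density m)"
    using orbit_law_restrict[of m n]
    by (simp add: density_gauss_rel_density sets_std_gauss cong: distr_cong)
  show "distr (density (std_gauss (m + n)) (gauss_rel_density (m + n))) (std_gauss n) ?B =
      density (std_gauss n) (gauss_rel_density n)"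
    using orbit_law_shift[of m n]
    by (simp add: density_gauss_rel_density sets_std_gauss cong: distr_cong)
qed (auto simp: gauss_rel_density_nonneg)

section \<open>Second moments and the entropy formula\<close>

lemma integrable_F_sq: "integrable M (\<lambda>\<omega>. (F ((T ^^ i) \<omega>))\<^sup>2)"
  and integral_F_sq: "(\<integral>\<omega>. (F ((T ^^ i) \<omega>))\<^sup>2 \<partial>M) = (L2_norm M F)\<^sup>2"
proof -
  have int: "integrable M (\<lambda>\<omega>. (F \<omega>)\<^sup>2)"
    using AC by (simp add: AC_def L2_functions_def)
  then have "integrable (distr M M (T ^^ i)) (\<lambda>\<omega>. (F \<omega>)\<^sup>2)"
    by (simp add: distr_funpow_T)
  then show "integrable M (\<lambda>\<omega>. (F ((T ^^ i) \<omega>))\<^sup>2)"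
    by (subst (asm) integrable_distr_eq) auto
  have "(\<integral>\<omega>. (F ((T ^^ i) \<omega>))\<^sup>2 \<partial>M) = (\<integral>\<omega>. (F \<omega>)\<^sup>2 \<partial>distr M M (T ^^ i))"
    by (subst integral_distr) auto
  also have "\<dots> = (L2_norm M F)\<^sup>2"
    by (simp add: distr_funpow_T L2_norm_def)
  finally show "(\<integral>\<omega>. (F ((T ^^ i) \<omega>))\<^sup>2 \<partial>M) = (L2_norm M F)\<^sup>2" .
qed

definition entropy_bound :: real where
  "entropy_bound = 1 / 2 * (ln (2 * pi) + (L2_norm M F)\<^sup>2)"

text \<open>The exponent is a sum of \<open>n\<close> terms, each of expectation
  \<open>entropy_bound\<close> by invariance of \<open>M\<close>. This is the cross term
  \<open>c\<close> of \<open>ext_integral_psi_eq\<close>; it depends on the process only through the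
  norm of \<open>F\<close>.\<close>

lemma nn_integral_gauss_exponent:
  "(\<integral>\<^sup>+x. ennreal (gauss_exponent n x) \<partial>orbit_law M T F n) = ennreal (real n * entropy_bound)"
proof -
  have [measurable]: "gauss_exponent n \<in> borel_measurable (PiM {..<n} (\<lambda>_. borel))"
    using borel_measurable_gauss_exponent[of n] by (simp add: sets_leb cong: measurable_cong_sets)
  have orbit: "gauss_exponent n (orbit_vec T F n \<omega>) =
      (\<Sum>i<n. ln (2 * pi) / 2 + (F ((T ^^ i) \<omega>))\<^sup>2 / 2)" for \<omega>
    by (simp add: gauss_exponent_def orbit_vec_def)
  have "(\<integral>\<^sup>+x. ennreal (gauss_exponent n x) \<partial>orbit_law M T F n) =
      (\<integral>\<^sup>+\<omega>. ennreal (gauss_exponent n (orbit_vec T F n \<omega>)) \<partial>M)"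
    unfolding orbit_law_def by (subst nn_integral_distr) auto
  also have "\<dots> = ennreal (\<integral>\<omega>. gauss_exponent n (orbit_vec T F n \<omega>) \<partial>M)"
  proof (rule nn_integral_eq_integral)
    show "integrable M (\<lambda>\<omega>. gauss_exponent n (orbit_vec T F n \<omega>))"
      unfolding orbit
      by (intro Bochner_Integration.integrable_sum Bochner_Integration.integrable_add
          integrable_const integrable_divide integrable_F_sq)
  qed (simp add: gauss_exponent_nonneg)
  also have "(\<integral>\<omega>. gauss_exponent n (orbit_vec T F n \<omega>) \<partial>M) = real n * entropy_bound"
    unfolding orbit
    by (subst Bochner_Integration.integral_sum)
      (auto simp: integrable_F_sq integral_F_sq prob_space entropy_bound_def add_divide_distrib)
  finally show ?thesis .
qed

lemma entropy_bound_nonneg: "entropy_bound \<ge> 0"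
proof -
  have "1 \<le> 2 * pi"
    using pi_ge_two by linarith
  then show ?thesis
    by (simp add: entropy_bound_def)
qed

lemma entropy_n_eq:
  "entropy_n M T F n = ereal (real n * entropy_bound) - enn2ereal (gauss_relative_entropy n)"
proof -
  have total: "(\<integral>\<^sup>+x. ennreal (g x) \<partial>N) = 1" if "prob_space (density N g)" "g \<in> borel_measurable N"
    for g :: "(nat \<Rightarrow> real) \<Rightarrow> real" and N
    using prob_space.emeasure_space_1[OF that(1)] that(2)
    by (simp add: emeasure_density cong: nn_integral_cong)
  have "ext_integral (leb n) (\<lambda>x. psi (orbit_density n x)) = ereal (real n * entropy_bound) -
    enn2ereal (relative_entropy (density (leb n) (\<lambda>x. ennreal (exp (- gauss_exponent n x))))
      (\<lambda>x. orbit_density n x / exp (- gauss_exponent n x)))"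
  proof (rule ext_integral_psi_eq)
    show "(\<integral>\<^sup>+x. ennreal (orbit_density n x) \<partial>leb n) = 1"
      by (rule total) (auto simp: density_orbit_density prob_space_orbit_law)
    show "(\<integral>\<^sup>+x. ennreal (exp (- gauss_exponent n x)) \<partial>leb n) = 1"
      by (rule total) (use prob_space_std_gauss[of n] in \<open>auto simp: std_gauss_eq_density\<close>)
    have "(\<integral>\<^sup>+x. ennreal (orbit_density n x * gauss_exponent n x) \<partial>leb n) =
        (\<integral>\<^sup>+x. ennreal (gauss_exponent n x) \<partial>orbit_law M T F n)"
      unfolding density_orbit_density[symmetric]
      by (subst nn_integral_density)
        (auto simp: ennreal_mult orbit_density_def gauss_exponent_nonneg)
    then show "(\<integral>\<^sup>+x. ennreal (orbit_density n x * gauss_exponent n x) \<partial>leb n) =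
        ennreal (real n * entropy_bound)"
      by (simp add: nn_integral_gauss_exponent)
  qed (auto simp: gauss_exponent_nonneg entropy_bound_nonneg orbit_density_def)
  moreover have "gauss_rel_density n = (\<lambda>x. orbit_density n x / exp (- gauss_exponent n x))"
    by (simp add: fun_eq_iff gauss_rel_density_def)
  ultimately show ?thesis
    unfolding entropy_n_def gauss_relative_entropy_def std_gauss_eq_density
    by (simp add: orbit_density_def)
qed

section \<open>Convergence of the entropy per step\<close>

text \<open>Taken as a supremum rather than a limit, so that its vanishing forces every term to
  vanish; Fekete's lemma identifies it with the limit.\<close>

definition gauss_entropy_rate :: ennreal where
  "gauss_entropy_rate = (SUP n\<in>{1..}. gauss_relative_entropy n / of_nat n)"

lemma gauss_entropy_rate_eq_0_iff:
  "gauss_entropy_rate = 0 \<longleftrightarrow> (\<forall>n\<ge>1. orbit_law M T F n = std_gauss n)"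
proof -
  have "gauss_entropy_rate = 0 \<longleftrightarrow> (\<forall>n\<ge>1. gauss_relative_entropy n / of_nat n = 0)"
    unfolding gauss_entropy_rate_def by (auto simp: SUP_bot_conv simp flip: bot_ennreal)
  also have "\<dots> \<longleftrightarrow> (\<forall>n\<ge>1. orbit_law M T F n = std_gauss n)"
    by (simp add: ennreal_divide_eq_0_iff gauss_relative_entropy_eq_0_iff)
  finally show ?thesis .
qed

lemma entropy_n_div_tendsto:
  "(\<lambda>n. entropy_n M T F n / ereal (real n)) \<longlonglongrightarrow> ereal entropy_bound - enn2ereal gauss_entropy_rate"
proof (rule Lim_transform_eventually)
  have "(\<lambda>n. gauss_relative_entropy n / of_nat n) \<longlonglongrightarrow> gauss_entropy_rate"
    unfolding gauss_entropy_rate_def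
    by (intro superadditive_tendsto_SUP gauss_relative_entropy_superadditive)
  \<comment> \<open>As \<open>entropy_bound\<close> is finite,
    \<open>\<infinity> - \<infinity>\<close> cannot occur, and the subtraction is continuous even at
    an infinite rate.\<close>
  then show "(\<lambda>n. ereal entropy_bound - enn2ereal (gauss_relative_entropy n / of_nat n))
      \<longlonglongrightarrow> ereal entropy_bound - enn2ereal gauss_entropy_rate"
    by (intro tendsto_diff_ereal_general) auto
  show "\<forall>\<^sub>F n in sequentially. ereal entropy_bound - enn2ereal (gauss_relative_entropy n / of_nat n) =
      entropy_n M T F n / ereal (real n)"
  proof (rule eventually_sequentiallyI[of 1])
    fix n :: nat assume n: "1 \<le> n"
    show "ereal entropy_bound - enn2ereal (gauss_relative_entropy n / of_nat n) =
      entropy_n M T F n / ereal (real n)"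
    \<comment> \<open>A finite value leaves a computation with reals; for an infinite one, both
      sides are \<open>-\<infinity>\<close>.\<close>
    proof (cases "gauss_relative_entropy n")
      case (real r)
      then have "gauss_relative_entropy n / of_nat n = ennreal (r / real n)"
        using n by (simp add: ennreal_of_nat_eq_real_of_nat divide_ennreal)
      then show ?thesis
        using n real by (simp add: entropy_n_eq enn2ereal_ennreal field_simps)
    next
      case top
      then show ?thesis
        using n by (simp add: entropy_n_eq ennreal_top_divide ereal_divide_eq)
    qed
  qed
qed

lemma Se_eq: "Se M T F = ereal entropy_bound - enn2ereal gauss_entropy_rate"
  unfolding Se_def by (rule limI) (rule entropy_n_div_tendsto)

end

theorem corollary4p5:
  fixes M :: "'a measure" and T :: "'a \<Rightarrow> 'a" and F :: "'a \<Rightarrow> real"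
  assumes "dynamical_system M T"
    and "F \<in> AC M T"
  shows "(\<lambda>n. entropy_n M T F n / ereal (real n)) \<longlonglongrightarrow> Se M T F
    \<and> Se M T F \<le> ereal (1 / 2 * (ln (2 * pi) + (L2_norm M F)\<^sup>2))
    \<and> (Se M T F = ereal (1 / 2 * (ln (2 * pi) + (L2_norm M F)\<^sup>2))
        \<longleftrightarrow> (\<forall>n\<ge>1. orbit_law M T F n = std_gauss n))"
proof -
  interpret AC_process M T F
    using assms by (simp add: AC_process_def AC_process_axioms_def)
  \<comment> \<open>With \<open>s\<close> the Gaussian entropy rate, this yields both the bound and
    its equality case. Equality forces \<open>s = 0\<close> because \<open>c\<close> is
    finite.\<close>
  have "ereal c - enn2ereal s \<le> ereal c \<and> (ereal c - enn2ereal s = ereal c \<longleftrightarrow> s = 0)" for c s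
    by (cases s) (auto simp: enn2ereal_ennreal)
  then show ?thesis
    unfolding entropy_bound_def[symmetric] gauss_entropy_rate_eq_0_iff[symmetric] Se_eq
    using entropy_n_div_tendsto by blast
qed

end
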